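(* The equation $(20^{n}-1)(77^{n}-1)=x^{2}$ in positive integers $n,x$ has only the solution $(n,x)=(1,38)$, and the equation $(12^{n}-1)(45^{n}-1)=x^{2}$ in positive integers $n,x$ has only the solution $(n,x)=(1,22)$. *)

theory Defs
  imports Complex_Main
begin

end

theory Submission
  imports Defs "HOL-Computational_Algebra.Nth_Powers"
begin

text \<open>
  Both equations have the form \<open>(a ^ n - 1) * (b ^ n - 1) = x\<^sup>2\<close> with \<open>a\<close> divisible by 4 and
  \<open>b\<close> congruent to 13 modulo 32. Even and odd exponents are excluded for different reasons.

  Let \<open>n = 2 * k\<close>. The two factors of a square agree up to squares, so \<open>a ^ k\<close> and \<open>b ^ k\<close> are
  the first components \<open>X\<close> of solutions of one Pell equation \<open>X\<^sup>2 - D * Y\<^sup>2 = 1\<close>. Every solution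
  is a power of the minimal one. An odd power has an \<open>X\<close> congruent modulo 2 to the minimal \<open>X\<close>,
  and an even power is the square of a solution \<open>(T, S)\<close>, so that \<open>X = 2 * T\<^sup>2 - 1\<close>. As \<open>a ^ k\<close> is
  even, it is an odd power and the minimal \<open>X\<close> is even; as \<open>b ^ k\<close> is odd, it is an even power.
  Hence \<open>b ^ k = 2 * T\<^sup>2 - 1\<close>
  (lemma \<open>even_exponent_twice_square_minus_one\<close>), which makes 2 a square modulo every odd prime
  factor of \<open>b\<close>. But 2 is not a square modulo 11, a factor of 77, nor modulo 5, a factor of 45.

  Let \<open>n\<close> be odd. As \<open>n = 1\<close> is a solution, an obstruction needs information that separates it
  from the residue class of 1 for every modulus. Powers of 2 provide it: for \<open>n \<ge> 3\<close> the number
  \<open>a ^ n\<close> vanishes modulo 32, whereas 20 and 12 do not, and then \<open>1 - b ^ n\<close> must be a square modulo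
  32, which forces \<open>n\<close> to be 5 modulo 8 (lemma \<open>odd_exponent_mod_8\<close>). This class is now covered
  by classes in which the product is a quadratic nonresidue modulo a prime for which the orders of
  \<open>a\<close> and \<open>b\<close> are small: the primes 17 and 97 suffice for 20 and 77, and the primes 13, 37 and 73
  for 12 and 45.
\<close>

section \<open>Pell equations and even exponents\<close>

text \<open>
  In the ring of numbers \<open>x + y * sqrt D\<close> the two alternatives are \<open>(t, s)\<^sup>2\<close> and
  \<open>(t, s)\<^sup>2 * (x1, y1)\<close>: every solution is an even or an odd power of the minimal solution. Recording
  only this parity avoids the sequence of all powers. The induction is Fermat descent: dividing a
  solution with \<open>y > 0\<close> by the minimal one gives a solution with a smaller \<open>y\<close>, and multiplying back
  exchanges the two alternatives.
\<close>

lemma pell_solution_square_or_square_times_minimal: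
  fixes D x1 y1 x y :: int
  assumes D: "D > 0"
    and min_sol: "x1\<^sup>2 = D * y1\<^sup>2 + 1" "x1 > 0" "y1 > 0"
    and minimal: "\<And>x y. x > 0 \<Longrightarrow> y > 0 \<Longrightarrow> x\<^sup>2 = D * y\<^sup>2 + 1 \<Longrightarrow> y1 \<le> y"
    and sol: "x\<^sup>2 = D * y\<^sup>2 + 1" "x > 0" "y \<ge> 0"
  shows "\<exists>t s. t\<^sup>2 = D * s\<^sup>2 + 1 \<and>
           (x = t\<^sup>2 + D * s\<^sup>2 \<and> y = 2 * t * s \<or>
            x = (t\<^sup>2 + D * s\<^sup>2) * x1 + D * (2 * t * s) * y1 \<and>
            y = (t\<^sup>2 + D * s\<^sup>2) * y1 + 2 * t * s * x1)"
  using sol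
proof (induction "nat y" arbitrary: x y rule: less_induct)
  case less
  show ?case
  proof (cases "y = 0")
    case True
    with less.prems have "x = 1" by (simp add: power2_eq_1_iff)
    with True show ?thesis by (intro exI[of _ 1] exI[of _ 0]) simp
  next
    case False
    with less.prems have "y1 \<le> y" using minimal by simp
    \<comment> \<open>The quotient by the minimal solution, whose inverse is its conjugate \<open>(x1, - y1)\<close>.\<close>
    define x' y' where "x' = x * x1 - D * y * y1" and "y' = y * x1 - x * y1"
    have norm: "x'\<^sup>2 = D * y'\<^sup>2 + 1"
    proof -
      have "x'\<^sup>2 - D * y'\<^sup>2 = (x\<^sup>2 - D * y\<^sup>2) * (x1\<^sup>2 - D * y1\<^sup>2)"
        by (simp add: x'_def y'_def power2_eq_square algebra_simps)
      then show ?thesis using less.prems(1) min_sol(1) by simp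
    qed
    \<comment> \<open>The signs of \<open>x'\<close> and \<open>y'\<close> follow by comparing the squares of their two terms.\<close>
    have "(D * y * y1)\<^sup>2 < (x * x1)\<^sup>2"
    proof -
      have "(x * x1)\<^sup>2 = (D * y * y1)\<^sup>2 + D * y\<^sup>2 + D * y1\<^sup>2 + 1"
        unfolding power_mult_distrib less.prems(1) min_sol(1)
        by (simp add: power2_eq_square algebra_simps)
      moreover have "D * y\<^sup>2 \<ge> 0" "D * y1\<^sup>2 \<ge> 0" using D by simp_all
      ultimately show ?thesis by linarith
    qed
    then have x'_pos: "x' > 0"
      using power2_less_imp_less[of "D * y * y1" "x * x1"] less.prems(2) min_sol(2)
      by (simp add: x'_def)
    have cross: "(y * x1)\<^sup>2 + y1\<^sup>2 = (x * y1)\<^sup>2 + y\<^sup>2"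
      unfolding power_mult_distrib less.prems(1) min_sol(1) by (simp add: algebra_simps)
    have "y1\<^sup>2 \<le> y\<^sup>2" using \<open>y1 \<le> y\<close> min_sol(3) by (intro power_mono) auto
    with cross have "(x * y1)\<^sup>2 \<le> (y * x1)\<^sup>2" by linarith
    then have y'_nonneg: "y' \<ge> 0"
      using power2_le_imp_le[of "x * y1" "y * x1"] less.prems(3) min_sol(2)
      by (simp add: y'_def)
    \<comment> \<open>Comparison of squares again, now for \<open>y' < y\<close>.\<close>
    have "(y * (x1 - 1))\<^sup>2 < (x * y1)\<^sup>2"
    proof -
      have "(y * (x1 - 1))\<^sup>2 = (y * x1)\<^sup>2 - y\<^sup>2 - 2 * y\<^sup>2 * (x1 - 1)"
        by (simp add: power2_eq_square algebra_simps)
      moreover have "2 * y\<^sup>2 * (x1 - 1) \<ge> 0" using min_sol(2) by simp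
      moreover have "y1\<^sup>2 > 0" using min_sol(3) by simp
      ultimately show ?thesis using cross by linarith
    qed
    then have "y * (x1 - 1) < x * y1"
      using power2_less_imp_less[of "y * (x1 - 1)" "x * y1"] less.prems(2) min_sol(3) by simp
    then have "y' < y" by (simp add: y'_def algebra_simps)
    then obtain t s where ts: "t\<^sup>2 = D * s\<^sup>2 + 1" and
      "x' = t\<^sup>2 + D * s\<^sup>2 \<and> y' = 2 * t * s \<or>
       x' = (t\<^sup>2 + D * s\<^sup>2) * x1 + D * (2 * t * s) * y1 \<and>
       y' = (t\<^sup>2 + D * s\<^sup>2) * y1 + 2 * t * s * x1"
      using less.hyps[of y' x'] norm x'_pos y'_nonneg by auto
    moreover have recombine: "x = x' * x1 + D * y' * y1" "y = x' * y1 + y' * x1"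
    proof -
      have "x' * x1 + D * y' * y1 = x * (x1\<^sup>2 - D * y1\<^sup>2)"
           "x' * y1 + y' * x1 = y * (x1\<^sup>2 - D * y1\<^sup>2)"
        by (simp_all add: x'_def y'_def power2_eq_square algebra_simps)
      then show "x = x' * x1 + D * y' * y1" "y = x' * y1 + y' * x1"
        using min_sol(1) by simp_all
    qed
    ultimately consider
        "x' = t\<^sup>2 + D * s\<^sup>2" "y' = 2 * t * s"
      | "x' = (t\<^sup>2 + D * s\<^sup>2) * x1 + D * (2 * t * s) * y1"
        "y' = (t\<^sup>2 + D * s\<^sup>2) * y1 + 2 * t * s * x1" by blast
    then show ?thesis
    proof cases
      case 1
      with ts recombine show ?thesis by blast
    next
      case 2
      \<comment> \<open>\<open>(t, s)\<^sup>2 * (x1, y1) * (x1, y1)\<close> is the square of \<open>(t, s) * (x1, y1)\<close>.\<close>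
      define t' s' where "t' = t * x1 + D * s * y1" and "s' = t * y1 + s * x1"
      have "t'\<^sup>2 - D * s'\<^sup>2 = (t\<^sup>2 - D * s\<^sup>2) * (x1\<^sup>2 - D * y1\<^sup>2)"
        by (simp add: t'_def s'_def power2_eq_square algebra_simps)
      then have "t'\<^sup>2 = D * s'\<^sup>2 + 1" using ts min_sol(1) by simp
      moreover have "x = t'\<^sup>2 + D * s'\<^sup>2" "y = 2 * t' * s'"
        unfolding recombine 2 t'_def s'_def by (simp_all add: power2_eq_square algebra_simps)
      ultimately show ?thesis by blast
    qed
  qed
qed

text \<open>
  An even \<open>A\<close> can only be an odd power of the minimal solution \<open>(x1, y1)\<close>, and this forces \<open>x1\<close> to be
  even. Then all odd powers have an even first component, so \<open>B\<close> belongs to an even power. The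
  solution \<open>(A, \<bar>u\<bar>)\<close> also ensures that a minimal solution exists.
\<close>
lemma pell_odd_solution_twice_square_minus_one:
  fixes A B D u v :: int
  assumes D: "D > 0"
    and A: "A\<^sup>2 = D * u\<^sup>2 + 1" "even A" "A > 0"
    and B: "B\<^sup>2 = D * v\<^sup>2 + 1" "odd B" "B > 0"
  shows "\<exists>T. B = 2 * T\<^sup>2 - 1"
proof -
  define S where "S y \<longleftrightarrow> y > 0 \<and> (\<exists>x>0. x\<^sup>2 = D * (int y)\<^sup>2 + 1)" for y
  have "u \<noteq> 0"
  proof
    assume "u = 0"
    with A have "A = 1" by (simp add: power2_eq_1_iff)
    with A(2) show False by simp
  qed
  with A have "S (nat \<bar>u\<bar>)" by (auto simp: S_def)
  then have least: "S (Least S)" by (rule LeastI)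
  define y1 where "y1 = int (Least S)"
  from least obtain x1 where x1: "x1\<^sup>2 = D * y1\<^sup>2 + 1" "x1 > 0" "y1 > 0"
    by (auto simp: S_def y1_def)
  have minimal: "y1 \<le> y" if "x > 0" "y > 0" "x\<^sup>2 = D * y\<^sup>2 + 1" for x y
  proof -
    have "S (nat y)" using that by (auto simp: S_def)
    then have "Least S \<le> nat y" by (rule Least_le)
    then show ?thesis using that by (simp add: y1_def)
  qed
  have dichotomy: "(\<exists>T. x = 2 * T\<^sup>2 - 1) \<or> (\<exists>m k. x = (2 * m + 1) * x1 + 2 * k)"
    if sol: "x\<^sup>2 = D * y\<^sup>2 + 1" "x > 0" for x y
  proof -
    obtain t s where ts: "t\<^sup>2 = D * s\<^sup>2 + 1"
      and "x = t\<^sup>2 + D * s\<^sup>2 \<or> x = (t\<^sup>2 + D * s\<^sup>2) * x1 + D * (2 * t * s) * y1"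
      using pell_solution_square_or_square_times_minimal
              [OF D x1, of x "\<bar>y\<bar>"] minimal sol by auto
    then show ?thesis
    proof (elim disjE)
      assume "x = t\<^sup>2 + D * s\<^sup>2"
      with ts have "x = 2 * t\<^sup>2 - 1" by simp
      then show ?thesis by blast
    next
      assume "x = (t\<^sup>2 + D * s\<^sup>2) * x1 + D * (2 * t * s) * y1"
      with ts have "x = (2 * (D * s\<^sup>2) + 1) * x1 + 2 * (D * t * s * y1)"
        by (simp add: algebra_simps)
      then show ?thesis by blast
    qed
  qed
  have "even x1"
    using dichotomy[OF A(1) A(3)] A(2) by (auto simp: even_diff)
  with dichotomy[OF B(1) B(3)] B(2) show ?thesis by auto
qed

text \<open>
  Take \<open>D = gcd P Q\<close>: the cofactors are coprime and their product is a square, so each is a square.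
\<close>
lemma square_product_common_kernel:
  fixes P Q :: nat
  assumes pos: "P > 0" "Q > 0" and eq: "P * Q = z\<^sup>2"
  obtains D u v where "D > 0" "P = D * u\<^sup>2" "Q = D * v\<^sup>2"
proof -
  define D where "D = gcd P Q"
  have "D > 0" using pos by (simp add: D_def)
  obtain p q where pq: "P = p * D" "Q = q * D" "coprime p q"
    using gcd_coprime_exists[of P Q] \<open>D > 0\<close> unfolding D_def by auto
  have scaled: "D\<^sup>2 * (p * q) = z\<^sup>2"
    using eq pq by (simp add: power2_eq_square algebra_simps)
  then have "D dvd z" by (metis dvd_triv_left pow_divides_pow_iff zero_less_numeral)
  then obtain w where "z = D * w" ..
  with scaled \<open>D > 0\<close> have "p * q = w\<^sup>2" by (simp add: power_mult_distrib)
  then have "is_nth_power 2 (p * q)" by (simp add: is_nth_power_def)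
  then have "is_nth_power 2 p" "is_nth_power 2 q"
    using is_nth_power_mult_coprime_natD[OF pq(3)] pos pq by auto
  then obtain u v where "p = u\<^sup>2" "q = v\<^sup>2" by (auto simp: is_nth_power_def)
  with that \<open>D > 0\<close> pq show ?thesis by (metis mult.commute)
qed

text \<open>
  For an even exponent both factors are one less than a square, so their common kernel \<open>D\<close> is the
  coefficient of a Pell equation that \<open>a ^ k\<close> and \<open>b ^ k\<close> share.
\<close>
lemma even_exponent_twice_square_minus_one:
  fixes a b x :: int
  assumes "even a" "a > 0" "odd b" "b > 1" "k > 0"
    and eq: "(a ^ (2 * k) - 1) * (b ^ (2 * k) - 1) = x\<^sup>2"
  shows "\<exists>T. b ^ k = 2 * T\<^sup>2 - 1"
proof -
  define P Q where "P = nat ((a ^ k)\<^sup>2 - 1)" and "Q = nat ((b ^ k)\<^sup>2 - 1)"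
  have "a > 1" using assms(1,2) by presburger
  then have "a ^ k > 1" using assms by (intro one_less_power) auto
  then have "(a ^ k)\<^sup>2 > 1" by (rule one_less_power) simp
  with \<open>a > 1\<close> have P: "int P = (a ^ k)\<^sup>2 - 1" "P > 0" by (auto simp: P_def)
  have "b ^ k > 1" using assms(4,5) by (intro one_less_power) auto
  then have "(b ^ k)\<^sup>2 > 1" by (rule one_less_power) simp
  with \<open>b > 1\<close> have Q: "int Q = (b ^ k)\<^sup>2 - 1" "Q > 0" by (auto simp: Q_def)
  have "int P * int Q = x\<^sup>2" using eq P(1) Q(1) by (simp add: mult.commute flip: power_mult)
  then have "int (P * Q) = int ((nat \<bar>x\<bar>)\<^sup>2)" by simp
  then have "P * Q = (nat \<bar>x\<bar>)\<^sup>2" by (simp only: of_nat_eq_iff)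
  then obtain D u v where D: "D > 0" "P = D * u\<^sup>2" "Q = D * v\<^sup>2"
    using square_product_common_kernel P(2) Q(2) by metis
  have "(a ^ k)\<^sup>2 = int D * (int u)\<^sup>2 + 1" "(b ^ k)\<^sup>2 = int D * (int v)\<^sup>2 + 1"
    using P(1) Q(1) D by simp_all
  then show ?thesis
    using pell_odd_solution_twice_square_minus_one[of "int D" "a ^ k" "int u" "b ^ k" "int v"]
      assms D(1)
    by simp
qed

text \<open>
  Modulo a divisor \<open>p\<close> of \<open>b\<close> the equation reads \<open>2 * T\<^sup>2 = 1\<close>, which has no solution when 2 is
  a quadratic nonresidue modulo \<open>p\<close>. The list over one period of \<open>p\<close> makes this hypothesis
  checkable by rewriting.
\<close>
lemma two_nonresidue_obstruction:
  fixes b p T :: int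
  assumes "b ^ k = 2 * T\<^sup>2 - 1" and "p dvd b" and "k > 0" and "p > 0"
    and nonresidue: "list_all (\<lambda>y. 2 * y\<^sup>2 mod p \<noteq> 1 mod p) [0..p - 1]"
  shows False
proof -
  have "p dvd b ^ k" using assms by (meson dvd_power dvd_trans)
  then have "2 * T\<^sup>2 mod p = 1 mod p" by (simp add: assms(1) mod_eq_dvd_iff)
  moreover have "2 * (T mod p)\<^sup>2 mod p = 2 * T\<^sup>2 mod p"
    by (metis mod_mult_right_eq power_mod)
  ultimately show False
    using nonresidue \<open>p > 0\<close> by (auto simp: list_all_iff)
qed

lemma even_exponent_impossible:
  fixes a b p x :: int
  assumes eq: "(a ^ n - 1) * (b ^ n - 1) = x\<^sup>2" and "even n" "n > 0"
    and "even a" "a > 0" "odd b" "b > 1" and "p dvd b" "p > 0"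
    and "list_all (\<lambda>y. 2 * y\<^sup>2 mod p \<noteq> 1 mod p) [0..p - 1]"
  shows False
proof -
  from \<open>even n\<close> obtain k where k: "n = 2 * k" ..
  with \<open>n > 0\<close> have "k > 0" by simp
  then show False
    using even_exponent_twice_square_minus_one[of a b k x] two_nonresidue_obstruction assms k
    by metis
qed

section \<open>Congruences and odd exponents\<close>

lemma power_mod_period:
  fixes a m :: int
  assumes "a ^ L mod m = 1"
  shows "a ^ n mod m = a ^ (n mod L) mod m"
proof -
  have "a ^ n = (a ^ L) ^ (n div L) * a ^ (n mod L)"
    by (simp flip: power_mult power_add)
  also have "\<dots> mod m = ((a ^ L mod m) ^ (n div L) mod m) * a ^ (n mod L) mod m"
    by (simp only: power_mod mod_mult_left_eq)
  finally show ?thesis using assms by (simp add: mod_mult_left_eq)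
qed

text \<open>
  The residues \<open>A\<close> and \<open>B\<close> need not be powers of \<open>a\<close> and \<open>b\<close>: for a modulus that is not coprime to
  \<open>a\<close> the residue of \<open>a ^ n\<close> is not periodic from the start; if 4 divides \<open>a\<close>, it is 0 modulo 32 for all \<open>n \<ge> 3\<close>.
\<close>
lemma square_residue_obstruction:
  fixes a b x m :: int
  assumes eq: "(a ^ n - 1) * (b ^ n - 1) = x\<^sup>2" and "m > 0"
    and a: "a ^ n mod m = A mod m" and b: "b ^ n mod m = B mod m"
    and nonresidue: "list_all (\<lambda>y. y\<^sup>2 mod m \<noteq> (A - 1) * (B - 1) mod m) [0..m - 1]"
  shows False
proof -
  have "(x mod m)\<^sup>2 mod m = (a ^ n - 1) * (b ^ n - 1) mod m"
    by (simp add: power_mod eq)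
  also have "\<dots> = (A - 1) * (B - 1) mod m"
    using a b by (intro mod_mult_cong mod_diff_cong) auto
  finally show False
    using nonresidue \<open>m > 0\<close> by (auto simp: list_all_iff)
qed

lemma square_equation_excludes_residue:
  fixes a b x m :: int
  assumes "(a ^ n - 1) * (b ^ n - 1) = x\<^sup>2" and "m > 0"
    and "a ^ L mod m = 1" and "b ^ L mod m = 1"
    and "list_all (\<lambda>y. y\<^sup>2 mod m \<noteq> (a ^ r - 1) * (b ^ r - 1) mod m) [0..m - 1]"
  shows "n mod L \<noteq> r"
  using square_residue_obstruction[OF assms(1,2) _ _ assms(5)]
    power_mod_period[OF assms(3), of n] power_mod_period[OF assms(4), of n] by blast

text \<open>
  This is the step that separates the solution \<open>n = 1\<close> from all larger odd exponents: \<open>a ^ n\<close> is 0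
  modulo 32 once \<open>n \<ge> 3\<close>. Modulo 32, \<open>b\<close> has order 8, and among the odd residues \<open>r\<close> modulo 8 only
  \<open>r = 5\<close> makes \<open>1 - 13 ^ r\<close> a square: it is then 4, while \<open>r = 1, 3, 7\<close> give 20, 12 and 28.
\<close>
lemma odd_exponent_mod_8:
  fixes a b x :: int
  assumes eq: "(a ^ n - 1) * (b ^ n - 1) = x\<^sup>2" and n: "odd n" "n \<noteq> 1"
    and a: "4 dvd a" and b: "b mod 32 = 13"
  shows "n mod 8 = 5"
proof -
  from n have "n \<ge> 3" by presburger
  have "(4::int) ^ 3 dvd a ^ 3" using a by (rule dvd_power_same)
  also have "\<dots> dvd a ^ n" using \<open>n \<ge> 3\<close> by (rule le_imp_power_dvd)
  finally have "32 dvd a ^ n" by (auto elim: dvd_trans[rotated])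
  then have a_n: "a ^ n mod 32 = 0 mod 32" by simp
  have b_pow: "b ^ k mod 32 = 13 ^ k mod 32" for k
    by (metis b power_mod)
  have "b ^ 8 mod 32 = 1" by (simp add: b_pow)
  then have b_n: "b ^ n mod 32 = 13 ^ (n mod 8) mod 32"
    using power_mod_period[of b 8 32 n] b_pow by simp
  have excluded: "n mod 8 \<noteq> r"
    if "list_all (\<lambda>y. y\<^sup>2 mod 32 \<noteq> (0 - 1) * (13 ^ r - 1) mod 32) [0..32 - 1 :: int]" for r
    using square_residue_obstruction[OF eq _ a_n _ that] b_n by auto
  have "n mod 8 \<noteq> 1" "n mod 8 \<noteq> 3" "n mod 8 \<noteq> 7"
    by (rule excluded, code_simp)+
  with n(1) show ?thesis by presburger
qed

lemma residue_lift:
  fixes n :: nat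
  assumes "n mod L = r" and "k > 0"
  shows "\<exists>j\<in>set [0..<k]. n mod (L * k) = L * j + r"
  using assms mod_mult2_eq[of n L k] by (intro bexI[of _ "n div L mod k"]) auto

text \<open>
  The orders of 20 and 77 divide 16 modulo 17 and divide 32 modulo 97, so two doublings of the
  modulus 8 exhaust the class of 5.
\<close>
lemma odd_exponent_20_77:
  fixes x :: int
  assumes eq: "(20 ^ n - 1) * (77 ^ n - 1) = x\<^sup>2" and "odd n"
  shows "n = 1"
proof (rule ccontr)
  assume "n \<noteq> 1"
  then have "n mod 8 = 5"
    using odd_exponent_mod_8[OF eq] \<open>odd n\<close> by simp
  moreover have "n mod 16 \<noteq> 5"
    by (rule square_equation_excludes_residue[OF eq, of 17]; code_simp)
  ultimately have "n mod 16 = 13" by presburger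
  then have "n mod 32 = 13 \<or> n mod 32 = 29"
    using residue_lift[of n 16 13 2] by (simp add: upt_rec)
  moreover have "n mod 32 \<noteq> 13" "n mod 32 \<noteq> 29"
    by (rule square_equation_excludes_residue[OF eq, of 97]; code_simp)+
  ultimately show False by blast
qed

text \<open>
  The class of 5 modulo 32 survives the primes 17 and 97, so here the class of 5 modulo 8 is refined
  at the prime 3 instead. The orders of 12 and 45 divide 12, 36 and 72 modulo 13, 37 and 73
  respectively. The first two primes leave only \<open>n\<close> congruent to 1 modulo 36, which together with
  5 modulo 8 is the class of 37 modulo 72.
\<close>
lemma odd_exponent_12_45:
  fixes x :: int
  assumes eq: "(12 ^ n - 1) * (45 ^ n - 1) = x\<^sup>2" and "odd n"
  shows "n = 1"
proof (rule ccontr)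
  assume "n \<noteq> 1"
  then have mod_8: "n mod 8 = 5"
    using odd_exponent_mod_8[OF eq] \<open>odd n\<close> by simp
  have "n mod 12 \<noteq> 5" "n mod 12 \<noteq> 9"
    by (rule square_equation_excludes_residue[OF eq, of 13]; code_simp)+
  with mod_8 have mod_12: "n mod 12 = 1" by presburger
  have "n mod 36 \<noteq> 13" "n mod 36 \<noteq> 25"
    by (rule square_equation_excludes_residue[OF eq, of 37]; code_simp)+
  with mod_12 have "n mod 36 = 1"
    using residue_lift[of n 12 1 3] by (simp add: upt_rec)
  then have "n mod 72 = 1 \<or> n mod 72 = 37"
    using residue_lift[of n 36 1 2] by (simp add: upt_rec)
  moreover have "n mod 72 mod 8 = 5"
    using mod_8 by (simp add: mod_mod_cancel)
  ultimately have "n mod 72 = 37" by auto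
  moreover have "n mod 72 \<noteq> 37"
    by (rule square_equation_excludes_residue[OF eq, of 73]; code_simp)
  ultimately show False by blast
qed

section \<open>The two equations\<close>

theorem corollary16:
  shows "{(n, x) | (n::nat) (x::int). n > 0 \<and> x > 0 \<and> (20 ^ n - 1) * (77 ^ n - 1) = x ^ 2} = {(1, 38)}
       \<and> {(n, x) | (n::nat) (x::int). n > 0 \<and> x > 0 \<and> (12 ^ n - 1) * (45 ^ n - 1) = x ^ 2} = {(1, 22)}"
proof -
  have first: "n = 1 \<and> x = 38"
    if "n > 0" "x > 0" and eq: "(20 ^ n - 1) * (77 ^ n - 1) = x ^ 2" for n :: nat and x :: int
  proof -
    have "odd n"
    proof
      assume "even n"
      show False
        by (rule even_exponent_impossible[OF eq \<open>even n\<close> \<open>n > 0\<close>, of 11]; code_simp)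
    qed
    then have "n = 1" using odd_exponent_20_77[OF eq] by simp
    moreover from this have "x\<^sup>2 = 38\<^sup>2" using eq by simp
    ultimately show ?thesis using \<open>x > 0\<close> by (simp only: power2_eq_iff) auto
  qed
  have second: "n = 1 \<and> x = 22"
    if "n > 0" "x > 0" and eq: "(12 ^ n - 1) * (45 ^ n - 1) = x ^ 2" for n :: nat and x :: int
  proof -
    have "odd n"
    proof
      assume "even n"
      show False
        by (rule even_exponent_impossible[OF eq \<open>even n\<close> \<open>n > 0\<close>, of 5]; code_simp)
    qed
    then have "n = 1" using odd_exponent_12_45[OF eq] by simp
    moreover from this have "x\<^sup>2 = 22\<^sup>2" using eq by simp
    ultimately show ?thesis using \<open>x > 0\<close> by (simp only: power2_eq_iff) auto
  qed
  show ?thesis using first second by auto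
qed

end
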